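(* Consider a differential algebraic equation (DAE) on $\mathcal I=[t_0,t_{\mathrm{end}}]$ of the form $$\mathbf{A}\mathbf{x}'+\mathbf{b}_1(\mathbf{U}\mathbf{x},t)+\mathbf{B}_2\mathbf{T}\mathbf{x}=0,$$ with constant matrices $\mathbf{A},\mathbf{B}_2,\mathbf{T},\mathbf{U}$, which has tractability index 2 and whose projectors $\mathbf{P},\mathbf{Q},\mathbf{T},\mathbf{U},\mathbf{Q}_1,\mathbf{Q}_1^*,\mathbf{P}_1^*$ are as specified in the context (canonical $\mathbf{Q}_1$; constant $\mathbf{P},\mathbf{Q},\mathbf{T},\mathbf{U}$ with $\mathbf{T}\mathbf{P}=0$; constant projector $\mathbf{Q}_1^*$ onto $\operatorname{Im}\mathbf{Q}_1(\mathbf{U}\mathbf{x},t)$). Consider two initial conditions at $t_0$: an inconsistent one, $\mathbf{x}(t_0)=\mathbf{x}^0$, and a consistent one, $\mathbf{x}(t_0)=\mathbf{x}_0$. Let $\mathbf{x}^2$ be the solution at time $t_2$ obtained after two implicit Euler steps starting from $\mathbf{x}^0$, and let $\mathbf{x}_2$ be the solution at time $t_2$ obtained after two implicit Euler steps starting from $\mathbf{x}_0$, both with the same time step sizes. If $$\mathbf{P}\mathbf{P}_1^*\mathbf{x}^0=\mathbf{P}\mathbf{P}_1^*\mathbf{x}_0,$$ then $\mathbf{x}^2=\mathbf{x}_2$.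
   Context: Setting. The unknown is $\mathbf{x}:\mathcal I\to\mathbb R^{n}$; $\mathbf{A},\mathbf{B}_2\in\mathbb R^{n\times n}$ are constant and $\mathbf{A}$ is singular; $\mathbf{b}_1$ is continuously differentiable in its first argument. A projector is an idempotent matrix; a projector onto a subspace $V$ is one with image $V$. Projectors and tractability index. Let $\mathbf{Q}$ be a constant projector onto $\ker\mathbf{A}$ and $\mathbf{P}=\mathbf{I}-\mathbf{Q}$. Write $\mathbf{b}(\mathbf{x},t)=\mathbf{b}_1(\mathbf{U}\mathbf{x},t)+\mathbf{B}_2\mathbf{T}\mathbf{x}$. Since $\mathbf{A}$ and $\mathbf{P}$ are constant, define $$\mathbf{B}(\mathbf{x},t)=\frac{\partial}{\partial\mathbf{x}}\mathbf{b}(\mathbf{x},t),\qquad \mathbf{A}_1(\mathbf{x},t)=\mathbf{A}+\mathbf{B}(\mathbf{x},t)\mathbf{Q}.$$ Let $\tilde{\mathbf{Q}}_1(\mathbf{x},t)$ be a projector onto $\ker\mathbf{A}_1(\mathbf{x},t)$ and $\tilde{\mathbf{G}}_2=\mathbf{A}_1+\mathbf{B}\mathbf{P}\tilde{\mathbf{Q}}_1$. The DAE has tractability index 2 if $\mathbf{A}$ and $\mathbf{A}_1(\mathbf{x},t)$ are singular and $\tilde{\mathbf{G}}_2(\mathbf{x},t)$ is nonsingular. Canonical projector. One takes $\mathbf{Q}_1=\tilde{\mathbf{Q}}_1\tilde{\mathbf{G}}_2^{-1}\mathbf{B}\mathbf{P}$, which is again a projector onto $\ker\mathbf{A}_1$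 and satisfies $\mathbf{Q}_1\mathbf{Q}=0$. Put $\mathbf{P}_1=\mathbf{I}-\mathbf{Q}_1$. For the DAE of the given form these matrices depend on $(\mathbf{x},t)$ only through $(\mathbf{U}\mathbf{x},t)$, so one writes $\mathbf{Q}_1(\mathbf{U}\mathbf{x},t)$, $\mathbf{P}_1(\mathbf{U}\mathbf{x},t)$. Constant projectors. The space $\operatorname{Im}\big(\mathbf{Q}\mathbf{Q}_1(\mathbf{U}\mathbf{x},t)\big)$ is independent of $\mathbf{x}$ and $t$; $\mathbf{T}$ is a constant projector onto it chosen such that $\mathbf{T}\mathbf{P}=0$, and $\mathbf{U}=\mathbf{I}-\mathbf{T}$. Constant $\mathbf{Q}_1^*$. There is a constant projector $\mathbf{Q}_1^*$ with $\operatorname{Im}\mathbf{Q}_1^*=\operatorname{Im}\mathbf{Q}_1(\mathbf{U}\mathbf{x},t)$ for all $\mathbf{x},t$; $\mathbf{P}_1^*=\mathbf{I}-\mathbf{Q}_1^*$. Consistency. A vector $\mathbf{x}_0$ is a consistent initial condition at $t_0$ if there is a solution $\mathbf{x}^*:\mathcal I\to\mathbb R^n$ of the DAE with $\mathbf{x}^*(t_0)=\mathbf{x}_0$; otherwise it is inconsistent. Implicit Euler. With time points $t_{i+1}=t_i+h$, $h>0$, one step from the value $\mathbf{z}_i$ at $t_i$ produces the value $\mathbf{z}_{i+1}$ at $t_{i+1}$ solving $$\mathbf{A}\frac{\mathbf{z}_{i+1}-\mathbf{z}_i}{h}+\mathbf{b}_1(\mathbf{U}\mathbf{z}_{i+1},t_{i+1})+\mathbf{B}_2\mathbf{T}\mathbf{z}_{i+1}=0.$$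 The implicit equations of the Euler steps considered are assumed to be uniquely solvable. *)

theory Defs
  imports "HOL-Analysis.Analysis"
begin

definition mat_ker :: "real^'n^'m \<Rightarrow> (real^'n) set" where
  "mat_ker M = {v. M *v v = 0}"

definition mat_im :: "real^'n^'m \<Rightarrow> (real^'m) set" where
  "mat_im M = range (\<lambda>v. M *v v)"

definition is_projector :: "real^'n^'n \<Rightarrow> bool" where
  "is_projector M \<longleftrightarrow> M ** M = M"

definition projector_onto :: "real^'n^'n \<Rightarrow> (real^'n) set \<Rightarrow> bool" where
  "projector_onto M V \<longleftrightarrow> is_projector M \<and> mat_im M = V"

definition C1_in_first_arg :: "(real^'n \<Rightarrow> real \<Rightarrow> real^'n) \<Rightarrow> real set \<Rightarrow> bool" where
  "C1_in_first_arg f I \<longleftrightarrow>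
     (\<forall>t\<in>I. (\<forall>y. (\<lambda>z. f z t) differentiable (at y)) \<and>
            continuous_on UNIV (\<lambda>y. jacobian (\<lambda>z. f z t) (at y)))"

definition dae_b ::
  "(real^'n \<Rightarrow> real \<Rightarrow> real^'n) \<Rightarrow> real^'n^'n \<Rightarrow> real^'n^'n \<Rightarrow> real^'n^'n
    \<Rightarrow> real^'n \<Rightarrow> real \<Rightarrow> real^'n" where
  "dae_b b1 B2 T U x t = b1 (U *v x) t + B2 *v (T *v x)"

text \<open>In the definitions below \<open>b\<close> is the derivative-free part of the DAE
  \<open>A x' + b(x, t) = 0\<close>.\<close>

definition dae_B :: "(real^'n \<Rightarrow> real \<Rightarrow> real^'n) \<Rightarrow> real^'n \<Rightarrow> real \<Rightarrow> real^'n^'n" where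
  "dae_B b x t = jacobian (\<lambda>y. b y t) (at x)"

definition dae_A1 ::
  "real^'n^'n \<Rightarrow> (real^'n \<Rightarrow> real \<Rightarrow> real^'n) \<Rightarrow> real^'n^'n
    \<Rightarrow> real^'n \<Rightarrow> real \<Rightarrow> real^'n^'n" where
  "dae_A1 A b Q x t = A + dae_B b x t ** Q"

definition dae_G2 ::
  "real^'n^'n \<Rightarrow> (real^'n \<Rightarrow> real \<Rightarrow> real^'n) \<Rightarrow> real^'n^'n
    \<Rightarrow> (real^'n \<Rightarrow> real \<Rightarrow> real^'n^'n) \<Rightarrow> real^'n \<Rightarrow> real \<Rightarrow> real^'n^'n" where
  "dae_G2 A b Q Qt1 x t = dae_A1 A b Q x t + dae_B b x t ** (mat 1 - Q) ** Qt1 x t"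

definition tractability_index_2 ::
  "real set \<Rightarrow> real^'n^'n \<Rightarrow> (real^'n \<Rightarrow> real \<Rightarrow> real^'n) \<Rightarrow> real^'n^'n
    \<Rightarrow> (real^'n \<Rightarrow> real \<Rightarrow> real^'n^'n) \<Rightarrow> bool" where
  "tractability_index_2 I A b Q Qt1 \<longleftrightarrow>
     \<not> invertible A \<and>
     (\<forall>x. \<forall>t\<in>I. \<not> invertible (dae_A1 A b Q x t) \<and> invertible (dae_G2 A b Q Qt1 x t))"

definition canonical_Q1 ::
  "real^'n^'n \<Rightarrow> (real^'n \<Rightarrow> real \<Rightarrow> real^'n) \<Rightarrow> real^'n^'n
    \<Rightarrow> (real^'n \<Rightarrow> real \<Rightarrow> real^'n^'n) \<Rightarrow> real^'n \<Rightarrow> real \<Rightarrow> real^'n^'n" where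
  "canonical_Q1 A b Q Qt1 x t =
     Qt1 x t ** matrix_inv (dae_G2 A b Q Qt1 x t) ** dae_B b x t ** (mat 1 - Q)"

text \<open>The derivative is taken within \<open>I\<close>, hence one-sided at the end points of an interval.\<close>

definition dae_solution ::
  "real set \<Rightarrow> real^'n^'n \<Rightarrow> (real^'n \<Rightarrow> real \<Rightarrow> real^'n) \<Rightarrow> (real \<Rightarrow> real^'n) \<Rightarrow> bool" where
  "dae_solution I A b x \<longleftrightarrow>
     (\<forall>t\<in>I. \<exists>x'. (x has_vector_derivative x') (at t within I) \<and> A *v x' + b (x t) t = 0)"

definition consistent_at ::
  "real set \<Rightarrow> real^'n^'n \<Rightarrow> (real^'n \<Rightarrow> real \<Rightarrow> real^'n) \<Rightarrow> real \<Rightarrow> real^'n \<Rightarrow> bool" where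
  "consistent_at I A b t0 x0 \<longleftrightarrow> (\<exists>x. dae_solution I A b x \<and> x t0 = x0)"

text \<open>\<open>implicit_euler_step A b h t z z'\<close>: the value \<open>z'\<close> at time \<open>t + h\<close> solves the equation of
  the implicit Euler step of size \<open>h\<close> that starts from the value \<open>z\<close> at time \<open>t\<close>.\<close>

definition implicit_euler_step ::
  "real^'n^'n \<Rightarrow> (real^'n \<Rightarrow> real \<Rightarrow> real^'n) \<Rightarrow> real \<Rightarrow> real
    \<Rightarrow> real^'n \<Rightarrow> real^'n \<Rightarrow> bool" where
  "implicit_euler_step A b h t z z' \<longleftrightarrow>
     A *v ((1 / h) *\<^sub>R (z' - z)) + b z' (t + h) = 0"

end

theory Submission
  imports Defs
begin

text \<open>
  Put \<open>d = xi0 - xc0\<close> and \<open>e = Q1s d\<close>. The hypothesis says \<open>d - e \<in> Im Q = ker A\<close>, so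
  \<open>A d = A e\<close>. Since \<open>e \<in> Im Q1 \<subseteq> ker A1\<close>, we get \<open>A e = - B Q e\<close>, and \<open>Q e \<in> Im (Q Q1) = Im T\<close>, on
  which the Jacobian \<open>B\<close> acts as the constant matrix \<open>B2\<close>. Hence \<open>xc1 - (1/h1) Q e\<close> solves the first
  Euler equation started at \<open>xi0\<close>, and by unique solvability it equals \<open>xi1\<close>. As \<open>Im T \<subseteq> ker A\<close>,
  \<open>A xi1 = A xc1\<close>, so the second steps solve the same equation.
\<close>

lemma projector_onto_fixes: "projector_onto M V \<Longrightarrow> v \<in> V \<Longrightarrow> M *v v = v"
  by (auto simp: projector_onto_def is_projector_def mat_im_def matrix_vector_mul_assoc)

lemma projector_onto_mem: "projector_onto M V \<Longrightarrow> M *v v \<in> V"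
  by (auto simp: projector_onto_def mat_im_def)

text \<open>Since \<open>mat 1 - T\<close> annihilates \<open>w\<close>, the nonlinear term
  \<open>b1\<close> does not see the shift.\<close>

lemma dae_b_add:
  assumes "T *v w = w"
  shows "dae_b b1 B2 T (mat 1 - T) (z + w) t = dae_b b1 B2 T (mat 1 - T) z t + B2 *v w"
  using assms by (simp add: dae_b_def algebra_simps)

text \<open>Chain rule and uniqueness of the derivative. The split isolates the nonlinear part,
  which drops out for directions that \<open>U\<close> annihilates.\<close>

lemma dae_B_mult_vec:
  assumes "(\<lambda>z. b1 z t) differentiable (at (U *v x))"
  shows "dae_B (dae_b b1 B2 T U) x t *v v
    = jacobian (\<lambda>z. b1 z t) (at (U *v x)) *v (U *v v) + B2 *v (T *v v)"
proof -
  define D where "D = (*v) (jacobian (\<lambda>z. b1 z t) (at (U *v x)))"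
  have D: "((\<lambda>z. b1 z t) has_derivative D) (at (U *v x))"
    using assms by (simp add: D_def jacobian_works)
  have lin: "((*v) M has_derivative (*v) M) F" for M :: "real^'n^'n" and F
    by (intro bounded_linear_imp_has_derivative matrix_vector_mul_bounded_linear)
  have der: "((\<lambda>y. dae_b b1 B2 T U y t) has_derivative (\<lambda>v. D (U *v v) + B2 *v (T *v v))) (at x)"
    unfolding dae_b_def
    by (rule has_derivative_add[OF has_derivative_compose[OF lin D] has_derivative_compose[OF lin lin]])
  then have "(\<lambda>y. dae_b b1 B2 T U y t) differentiable (at x)"
    by (rule differentiableI)
  then have *: "(*v) (jacobian (\<lambda>y. dae_b b1 B2 T U y t) (at x))
      = (\<lambda>v. D (U *v v) + B2 *v (T *v v))"
    using der has_derivative_unique unfolding jacobian_works by blast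
  show ?thesis
    using fun_cong[OF *, of v] by (simp add: dae_B_def D_def)
qed

text \<open>The leftmost factor of the product \<open>canonical_Q1\<close> is
  \<open>Qt1 x t\<close>.\<close>

lemma canonical_Q1_im_subset:
  assumes "projector_onto (Qt1 x t) V"
  shows "mat_im (canonical_Q1 A b Q Qt1 x t) \<subseteq> V"
  using projector_onto_mem[OF assms]
  by (auto simp: mat_im_def canonical_Q1_def simp flip: matrix_vector_mul_assoc)

text \<open>The starting value enters the step equation only through its image under
  \<open>A\<close>, so a difference in \<open>ker A\<close> is forgotten by the next step.\<close>

lemma implicit_euler_step_cong:
  assumes "A *v z = A *v y"
  shows "implicit_euler_step A b h t z = implicit_euler_step A b h t y"
  using assms by (simp add: fun_eq_iff implicit_euler_step_def algebra_simps)

theorem proposition2: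
  fixes A B2 P Q T U Q1s P1s :: "real^'n^'n"
    and b1 b :: "real^'n \<Rightarrow> real \<Rightarrow> real^'n"
    and Qt1 Q1 :: "real^'n \<Rightarrow> real \<Rightarrow> real^'n^'n"
    and I :: "real set"
    and t0 t1 t2 tend h1 h2 :: real
    and xi0 xi1 xi2 xc0 xc1 xc2 :: "real^'n"
  assumes I: "I = {t0..tend}"
    and b1: "C1_in_first_arg b1 I"
    and b: "b = dae_b b1 B2 T U"
    and Q: "projector_onto Q (mat_ker A)"
    and P: "P = mat 1 - Q"
    and Qt1: "\<And>x t. t \<in> I \<Longrightarrow> projector_onto (Qt1 x t) (mat_ker (dae_A1 A b Q x t))"
    and index2: "tractability_index_2 I A b Q Qt1"
    and Q1: "Q1 = canonical_Q1 A b Q Qt1"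
    and T: "\<And>x t. t \<in> I \<Longrightarrow> projector_onto T (mat_im (Q ** Q1 x t))"
    and TP: "T ** P = 0"
    and U: "U = mat 1 - T"
    and Q1s: "\<And>x t. t \<in> I \<Longrightarrow> projector_onto Q1s (mat_im (Q1 x t))"
    and P1s: "P1s = mat 1 - Q1s"
    and inconsistent: "\<not> consistent_at I A b t0 xi0"
    and consistent: "consistent_at I A b t0 xc0"
    and h1: "h1 > 0" and h2: "h2 > 0"
    and t1: "t1 = t0 + h1" and t2: "t2 = t1 + h2" and tend: "t2 \<le> tend"
    and solvable_i1: "\<exists>!z. implicit_euler_step A b h1 t0 xi0 z"
    and solvable_i2: "\<exists>!z. implicit_euler_step A b h2 t1 xi1 z"
    and solvable_c1: "\<exists>!z. implicit_euler_step A b h1 t0 xc0 z"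
    and solvable_c2: "\<exists>!z. implicit_euler_step A b h2 t1 xc1 z"
    and euler_i1: "implicit_euler_step A b h1 t0 xi0 xi1"
    and euler_i2: "implicit_euler_step A b h2 t1 xi1 xi2"
    and euler_c1: "implicit_euler_step A b h1 t0 xc0 xc1"
    and euler_c2: "implicit_euler_step A b h2 t1 xc1 xc2"
    and eq: "(P ** P1s) *v xi0 = (P ** P1s) *v xc0"
  shows "xi2 = xc2"
proof -
  have "t0 \<in> I" and "t1 \<in> I"
    using I h1 h2 t1 t2 tend by auto
  have AQ: "A *v (Q *v v) = 0" for v
    using projector_onto_mem[OF Q, of v] by (simp add: mat_ker_def)
  define d where "d = xi0 - xc0"
  define e where "e = Q1s *v d"
  have "(P ** P1s) *v d = 0"
    using eq by (simp add: d_def matrix_vector_mult_diff_distrib)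
  \<comment> \<open>Here \<open>P1s *v d = d - e\<close>, and \<open>P\<close> vanishes exactly on
    the fixed vectors of \<open>Q\<close>.\<close>
  then have "d - e = Q *v (d - e)"
    by (simp add: P P1s e_def algebra_simps flip: matrix_vector_mul_assoc)
  then have "A *v (d - e) = 0"
    using AQ by metis
  then have Ad: "A *v d = A *v e"
    by (simp add: algebra_simps)
  \<comment> \<open>\<open>Q1s\<close> and \<open>T\<close> do not depend on the state, so any state
    would do and \<open>0\<close> is taken. The time is \<open>t1\<close> because the implicit step
    evaluates \<open>b\<close> there.\<close>
  have e_im: "e \<in> mat_im (Q1 0 t1)"
    unfolding e_def by (rule projector_onto_mem[OF Q1s[where x = 0, OF \<open>t1 \<in> I\<close>]])
  then have "e \<in> mat_ker (dae_A1 A b Q 0 t1)"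
    using canonical_Q1_im_subset[of Qt1, OF Qt1[where x = 0, OF \<open>t1 \<in> I\<close>]] by (auto simp: Q1)
  then have Ae: "A *v e + dae_B b 0 t1 *v (Q *v e) = 0"
    by (simp add: mat_ker_def dae_A1_def algebra_simps flip: matrix_vector_mul_assoc)
  have "Q *v e \<in> mat_im (Q ** Q1 0 t1)"
    using e_im by (auto simp: mat_im_def simp flip: matrix_vector_mul_assoc)
  then have TQe: "T *v (Q *v e) = Q *v e"
    by (rule projector_onto_fixes[OF T[where x = 0, OF \<open>t1 \<in> I\<close>]])
  \<comment> \<open>The Jacobian of \<open>b1\<close> will only be applied to
    \<open>U *v (Q *v e)\<close>, which is zero by \<open>TQe\<close>.\<close>
  have "(\<lambda>z. b1 z t1) differentiable (at (U *v 0))"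
    using b1 \<open>t1 \<in> I\<close> by (auto simp: C1_in_first_arg_def)
  then have "dae_B b 0 t1 *v (Q *v e) = B2 *v (Q *v e)"
    unfolding b by (subst dae_B_mult_vec) (simp_all add: U TQe algebra_simps)
  with Ae Ad have Ad': "B2 *v (Q *v e) = - (A *v d)"
    by (simp add: eq_neg_iff_add_eq_0 add.commute)
  \<comment> \<open>Replacing \<open>xc0\<close> by \<open>xi0\<close> changes the residual by
    \<open>-(1 / h1)\<close> times \<open>A *v d\<close>. The correction \<open>w\<close> is scaled
    so that \<open>B2 *v w\<close> cancels this, while \<open>A *v w = 0\<close> adds
    nothing.\<close>
  define w where "w = - ((1 / h1) *\<^sub>R (Q *v e))"
  have Tw: "T *v w = w" and Aw: "A *v w = 0" and Bw: "B2 *v w = (1 / h1) *\<^sub>R (A *v d)"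
    by (simp_all add: w_def TQe AQ Ad' vec.neg matrix_vector_mult_scaleR)
  have bw: "b (xc1 + w) t1 = b xc1 t1 + B2 *v w"
    unfolding b U by (rule dae_b_add[OF Tw])
  have "A *v ((1 / h1) *\<^sub>R (xc1 - xc0)) + b xc1 t1 = 0"
    using euler_c1 by (simp add: implicit_euler_step_def t1)
  then have "A *v ((1 / h1) *\<^sub>R (xc1 + w - xi0)) + b (xc1 + w) t1 = 0"
    unfolding bw Bw by (simp add: Aw d_def algebra_simps)
  then have "implicit_euler_step A b h1 t0 xi0 (xc1 + w)"
    by (simp add: implicit_euler_step_def t1)
  then have "xi1 = xc1 + w"
    using solvable_i1 euler_i1 by blast
  then have "A *v xi1 = A *v xc1"
    by (simp add: algebra_simps Aw)
  then have "implicit_euler_step A b h2 t1 xi1 = implicit_euler_step A b h2 t1 xc1"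
    by (rule implicit_euler_step_cong)
  with euler_c2 have "implicit_euler_step A b h2 t1 xi1 xc2"
    by metis
  then show ?thesis
    using solvable_i2 euler_i2 by blast
qed

end
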